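(* Let $(Q,\Delta_Q,A,S)$ be a domain, $(PG,RID)$ an understanding criterion, and $ans:Q\to A$ a question-answering system (agent). Let $n\ge 1$ be an integer and $\delta\in(0,1)$. Let $q_1,\dots,q_n$ be drawn independently from $\Delta_Q$, put $s_i=S(q_i,ans(q_i))$, $r_i=1$ if $s_i=0$ and $r_i=0$ otherwise, $\hat s=\frac1n\sum_{i=1}^n s_i$ and $\hat r=\frac1n\sum_{i=1}^n r_i$. Consider the following testing procedure: 1. Determine "the agent understands the scope $Q$" if both $L(\hat s,n,\delta)\ge PG$ and $U(\hat r,n,\delta)\le RID$. 2. Determine "the agent does not understand the scope $Q$" if $U(\hat s,n,\delta/2)<PG$ or $L(\hat r,n,\delta/2)>RID$. 3. Otherwise, draw no conclusion. Then whatever conclusion the procedure draws is correct with probability at least $1-\delta$. That is, the probability, over the draw of $q_1,\dots,q_n$, that the procedure draws an incorrect conclusion is at most $\delta$: if the agent does not understand the scope $Q$, then the probability that the procedure determines that it understands is at most $\delta$; and if the agent understands the scope $Q$, then the probability that the procedure determines that it does not understand is at most $\delta$.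
   Context: A domain is a tuple $(Q,\Delta_Q,A,S)$ where $Q$ is a set of questions, $\Delta_Q$ is a probability distribution over $Q$, $A$ is a set of answers containing a distinguished element $idk$ ("I don't know"), and $S:Q\times A\to[0,1]$ is a scoring function. (As usual, $q\mapsto S(q,ans(q))$ is assumed measurable.) An answer $a$ to $q$ is ridiculous if $S(q,a)=0$. An understanding criterion is a pair $(PG,RID)$ with $PG\in(0,1)$ and $RID\in(0,1)$ (informally $RID$ is much smaller than $PG$; no quantitative relation is imposed). Put $s=\mathbb{E}_{q\sim\Delta_Q}[S(q,ans(q))]$ and $r=P_{q\sim\Delta_Q}(S(q,ans(q))=0)$. The agent $ans$ understands the scope $Q$ if and only if $s\ge PG$ and $r\le RID$. For $x,y\in[0,1]$ let $d(x,y)=x\ln\frac{x}{y}+(1-x)\ln\frac{1-x}{1-y}$ be the relative entropy between Bernoulli distributions with parameters $x$ and $y$, with singularities replaced by limit values: $d(0,y)=\ln\frac1{1-y}$ for $y\ne1$, $d(1,y)=\ln\frac1y$ for $y\neq 0$ (so $d(0,0)=d(1,1)=0$), and $d(x,y)=\infty$ if $x>0,y=0$ or if $x<1,y=1$. For $x\in[0,1]$, an integer $n\ge1$ and $\delta\in(0,1)$ define $$U(x,n,\delta)=\max\{y\in[0,1]: d(x,y)\le \ln(1/\delta)/n\},\qquad L(x,n,\delta)=\min\{y\in[0,1]: d(x,y)\le \ln(1/\delta)/n\}.$$ *)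

theory Defs
  imports "HOL-Probability.Probability"
begin

locale qa_domain = prob_space D
  for Q :: "'q set" and D :: "'q measure" and A :: "'a set" and idk :: 'a
    and S :: "'q \<Rightarrow> 'a \<Rightarrow> real" +
  assumes space_D: "space D = Q"
    and idk_answer: "idk \<in> A"
    and score_range: "\<And>q a. q \<in> Q \<Longrightarrow> a \<in> A \<Longrightarrow> S q a \<in> {0..1}"

definition ridiculous :: "('q \<Rightarrow> 'a \<Rightarrow> real) \<Rightarrow> 'q \<Rightarrow> 'a \<Rightarrow> bool" where
  "ridiculous S q a \<longleftrightarrow> S q a = 0"

definition understanding_criterion :: "real \<Rightarrow> real \<Rightarrow> bool" where
  "understanding_criterion PG RID \<longleftrightarrow> PG \<in> {0<..<1} \<and> RID \<in> {0<..<1}"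

definition expected_score :: "'q measure \<Rightarrow> ('q \<Rightarrow> 'a \<Rightarrow> real) \<Rightarrow> ('q \<Rightarrow> 'a) \<Rightarrow> real" where
  "expected_score D S ans = (LINT q|D. S q (ans q))"

definition ridiculous_prob :: "'q measure \<Rightarrow> ('q \<Rightarrow> 'a \<Rightarrow> real) \<Rightarrow> ('q \<Rightarrow> 'a) \<Rightarrow> real" where
  "ridiculous_prob D S ans = \<P>(q in D. ridiculous S q (ans q))"

definition understands ::
    "'q measure \<Rightarrow> ('q \<Rightarrow> 'a \<Rightarrow> real) \<Rightarrow> real \<Rightarrow> real \<Rightarrow> ('q \<Rightarrow> 'a) \<Rightarrow> bool" where
  "understands D S PG RID ans \<longleftrightarrow>
     expected_score D S ans \<ge> PG \<and> ridiculous_prob D S ans \<le> RID"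

text \<open>Relative entropy of Bernoulli distributions with parameters \<open>x\<close> and \<open>y\<close>, both in \<open>[0,1]\<close>;
  the values on the boundary are the limits, not those that \<open>ln 0 = 0\<close> and division by zero would
  give.\<close>

definition bernoulli_kl :: "real \<Rightarrow> real \<Rightarrow> ereal" where
  "bernoulli_kl x y =
     (if x = 0 then (if y = 1 then \<infinity> else ereal (ln (1 / (1 - y))))
      else if x = 1 then (if y = 0 then \<infinity> else ereal (ln (1 / y)))
      else if y = 0 \<or> y = 1 then \<infinity>
      else ereal (x * ln (x / y) + (1 - x) * ln ((1 - x) / (1 - y))))"

text \<open>The sets whose maximum and minimum are taken are in general infinite, so \<open>Max\<close> and \<open>Min\<close>
  do not apply.\<close>

definition kl_upper :: "real \<Rightarrow> nat \<Rightarrow> real \<Rightarrow> real" where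
  "kl_upper x n \<delta> =
     (GREATEST y. y \<in> {0..1} \<and> bernoulli_kl x y \<le> ereal (ln (1 / \<delta>) / real n))"

definition kl_lower :: "real \<Rightarrow> nat \<Rightarrow> real \<Rightarrow> real" where
  "kl_lower x n \<delta> =
     (LEAST y. y \<in> {0..1} \<and> bernoulli_kl x y \<le> ereal (ln (1 / \<delta>) / real n))"

definition sample_score ::
    "('q \<Rightarrow> 'a \<Rightarrow> real) \<Rightarrow> ('q \<Rightarrow> 'a) \<Rightarrow> nat \<Rightarrow> (nat \<Rightarrow> 'q) \<Rightarrow> real" where
  "sample_score S ans n q = (1 / real n) * (\<Sum>i=1..n. S (q i) (ans (q i)))"

definition sample_ridiculous ::
    "('q \<Rightarrow> 'a \<Rightarrow> real) \<Rightarrow> ('q \<Rightarrow> 'a) \<Rightarrow> nat \<Rightarrow> (nat \<Rightarrow> 'q) \<Rightarrow> real" where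
  "sample_ridiculous S ans n q =
     (1 / real n) * (\<Sum>i=1..n. if ridiculous S (q i) (ans (q i)) then 1 else 0)"

datatype verdict = Understands | Does_Not_Understand | No_Conclusion

text \<open>The order of the two tests does not matter: since \<open>kl_lower\<close> never exceeds \<open>kl_upper\<close>,
  whichever confidence levels they are taken at, the two conditions exclude each other.\<close>

definition understanding_test ::
    "('q \<Rightarrow> 'a \<Rightarrow> real) \<Rightarrow> ('q \<Rightarrow> 'a) \<Rightarrow> real \<Rightarrow> real \<Rightarrow> nat \<Rightarrow> real \<Rightarrow> (nat \<Rightarrow> 'q) \<Rightarrow> verdict" where
  "understanding_test S ans PG RID n \<delta> q =
     (if kl_lower (sample_score S ans n q) n \<delta> \<ge> PG \<and>
         kl_upper (sample_ridiculous S ans n q) n \<delta> \<le> RID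
      then Understands
      else if kl_upper (sample_score S ans n q) n (\<delta> / 2) < PG \<or>
              kl_lower (sample_ridiculous S ans n q) n (\<delta> / 2) > RID
      then Does_Not_Understand
      else No_Conclusion)"

fun incorrect :: "bool \<Rightarrow> verdict \<Rightarrow> bool" where
  "incorrect truth Understands \<longleftrightarrow> \<not> truth"
| "incorrect truth Does_Not_Understand \<longleftrightarrow> truth"
| "incorrect truth No_Conclusion \<longleftrightarrow> False"

text \<open>Law of questions \<open>q 1, \<dots>, q n\<close> drawn independently from \<open>D\<close>.\<close>

abbreviation sample_space :: "'q measure \<Rightarrow> nat \<Rightarrow> (nat \<Rightarrow> 'q) measure" where
  "sample_space D n \<equiv> PiM {1..n} (\<lambda>_. D)"

end

theory Submission
  imports Defs
begin

text \<open>
  Relative entropy is used only through its variational form: \<open>d(x,y)\<close> is the supremum over real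
  \<open>t\<close> of \<open>t x - ln (1 - y + y exp t)\<close>. This makes \<open>{y. d(x,y) \<le> c}\<close> compact, so that the extrema
  exist, and makes the lower bound monotone in \<open>x\<close>, hence measurable. If the lower bound exceeds the true
  mean \<open>\<mu>\<close>, some \<open>t \<ge> 0\<close> satisfies \<open>t x - ln (1 - \<mu> + \<mu> exp t) > ln (1/\<delta>) / n\<close> at the sample
  mean \<open>x\<close>; for each fixed threshold \<open>x\<close> with this property Chernoff's bound gives a tail probability
  of at most \<open>\<delta>\<close>. The thresholds form an up-closed set, so the bound passes to the whole event by
  continuity of measure. The upper bound follows by replacing scores \<open>f\<close> by \<open>1 - f\<close>. An incorrect
  positive verdict forces one fixed bound to fail at level \<open>\<delta>\<close>, an incorrect negative verdict one of
  two at level \<open>\<delta>/2\<close> each.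
\<close>

section \<open>Variational form of the Bernoulli relative entropy\<close>

text \<open>The logarithm is the cumulant generating function at \<open>t\<close> of a Bernoulli
  variable with mean \<open>y\<close>, so this is the exponent that Chernoff's bound with tilt
  \<open>t\<close> gives for the threshold \<open>x\<close>.\<close>

definition kl_dual :: "real \<Rightarrow> real \<Rightarrow> real \<Rightarrow> real" where
  "kl_dual t x y = t * x - ln (1 - y + y * exp t)"

lemma bernoulli_mgf_pos:
  fixes y t :: real
  assumes "y \<in> {0..1}"
  shows "1 - y + y * exp t > 0"
proof (cases "y = 1")
  case False
  then have "1 - y > 0" "y * exp t \<ge> 0" using assms by auto
  then show ?thesis by linarith
qed simp

text \<open>Jensen's inequality for \<open>exp\<close> on the points 0 and \<open>t\<close>. Its
  main use is to read off signs: a positive value forces \<open>t\<close> and \<open>x - y\<close>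
  to have the same strict sign.\<close>

lemma kl_dual_le:
  assumes "y \<in> {0..1}"
  shows "kl_dual t x y \<le> t * (x - y)"
proof -
  have "exp ((1 - y) *\<^sub>R 0 + y *\<^sub>R t) \<le> (1 - y) * exp 0 + y * exp t"
    using assms by (intro convex_onD[OF exp_convex]) auto
  then have "exp (t * y) \<le> 1 - y + y * exp t"
    by (simp add: mult.commute)
  then have "t * y \<le> ln (1 - y + y * exp t)"
    using bernoulli_mgf_pos[OF assms] by (subst ln_ge_iff) auto
  then show ?thesis
    by (simp add: kl_dual_def right_diff_distrib)
qed

text \<open>Swapping the two outcomes of a Bernoulli variable reverses the tilt. This symmetry
  reduces \<open>x = 1\<close> to \<open>x = 0\<close>.\<close>

lemma kl_dual_flip:
  assumes "y \<in> {0..1}"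
  shows "kl_dual (- t) (1 - x) (1 - y) = kl_dual t x y"
proof -
  have "1 - (1 - y) + (1 - y) * exp (- t) = exp (- t) * (1 - y + y * exp t)"
    by (simp add: algebra_simps flip: exp_add)
  then have "ln (1 - (1 - y) + (1 - y) * exp (- t)) = - t + ln (1 - y + y * exp t)"
    using bernoulli_mgf_pos[OF assms, of t] by (simp add: ln_mult)
  then show ?thesis
    by (simp add: kl_dual_def algebra_simps)
qed

lemma bernoulli_kl_flip: "bernoulli_kl (1 - x) (1 - y) = bernoulli_kl x y"
  by (auto simp: bernoulli_kl_def)

text \<open>The easy half of the duality. Interior points use Gibbs' inequality against a tilted
  law; the case \<open>x = 0\<close> is monotonicity of \<open>ln\<close>, and \<open>x = 1\<close>
  is its mirror image.\<close>

lemma kl_dual_le_bernoulli_kl: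
  assumes x: "x \<in> {0..1}" and y: "y \<in> {0..1}"
  shows "ereal (kl_dual t x y) \<le> bernoulli_kl x y"
proof -
  have zero: "ereal (kl_dual t 0 y) \<le> bernoulli_kl 0 y" if y: "y \<in> {0..1}" for t y
  proof (cases "y = 1")
    case False
    then have "ln (1 - y) \<le> ln (1 - y + y * exp t)"
      using y by (intro ln_mono) auto
    then show ?thesis
      using False y by (simp add: bernoulli_kl_def kl_dual_def ln_div)
  qed (simp add: bernoulli_kl_def)
  consider "x = 0" | "x = 1" | "x \<in> {0<..<1}" "y = 0 \<or> y = 1" | "x \<in> {0<..<1}" "y \<in> {0<..<1}"
    using x y by fastforce
  then show ?thesis
  proof cases
    case 1
    then show ?thesis using zero[OF y] by simp
  next
    case 2
    then show ?thesis
      using zero[of "1 - y" "- t"] y kl_dual_flip[OF y, of t x] bernoulli_kl_flip[of x y] by simp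
  next
    case 3
    then show ?thesis by (auto simp: bernoulli_kl_def)
  next
    case 4
    define Z where "Z = 1 - y + y * exp t"
    have Z: "Z > 0" using bernoulli_mgf_pos[OF y] by (simp add: Z_def)
    \<comment> \<open>The weights \<open>y * exp t / Z\<close> and \<open>(1 - y) / Z\<close> form
      the Bernoulli law tilted by \<open>t\<close>. The left side is minus the relative entropy of
      the law with parameter \<open>x\<close> to it, and \<open>ln z \<le> z - 1\<close> shows that
      this is nonpositive.\<close>
    have "x * ln (y * exp t / (x * Z)) + (1 - x) * ln ((1 - y) / ((1 - x) * Z))
       \<le> x * (y * exp t / (x * Z) - 1) + (1 - x) * ((1 - y) / ((1 - x) * Z) - 1)"
      using 4 Z by (intro add_mono mult_left_mono ln_le_minus_one) auto
    also have "\<dots> = (y * exp t + (1 - y)) / Z - 1"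
      using 4 Z by (simp add: field_simps)
    also have "\<dots> = 0"
      using Z by (simp add: Z_def add.commute)
    finally have *: "x * ln (y * exp t / (x * Z)) + (1 - x) * ln ((1 - y) / ((1 - x) * Z)) \<le> 0" .
    have 1: "ln (y * exp t / (x * Z)) = ln y + t - ln x - ln Z"
      using 4 Z by (simp add: ln_div ln_mult)
    have 2: "ln ((1 - y) / ((1 - x) * Z)) = ln (1 - y) - ln (1 - x) - ln Z"
      using 4 Z by (simp add: ln_div ln_mult)
    have "t * x - ln Z \<le> x * (ln x - ln y) + (1 - x) * (ln (1 - x) - ln (1 - y))"
      using * unfolding 1 2 by (simp add: algebra_simps)
    then show ?thesis
      using 4 by (simp add: bernoulli_kl_def kl_dual_def ln_div flip: Z_def)
  qed
qed

text \<open>The supremum reaches the relative entropy: at a stationary point when both parameters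
  are interior, and otherwise as \<open>t\<close> tends to plus or minus infinity.\<close>

lemma bernoulli_kl_le_if_kl_dual_le:
  assumes x: "x \<in> {0..1}" and y: "y \<in> {0..1}" and le: "\<And>t. kl_dual t x y \<le> c"
  shows "bernoulli_kl x y \<le> ereal c"
proof -
  have zero: "bernoulli_kl 0 y \<le> ereal c" if y: "y \<in> {0..1}" and le: "\<And>t. kl_dual t 0 y \<le> c" for y
  proof (cases "y = 1")
    case True
    \<comment> \<open>For \<open>y = 1\<close> the dual is \<open>- t\<close>, which takes the value
      \<open>c + 1\<close> at this \<open>t\<close>; the hypothesis is contradictory.\<close>
    then show ?thesis
      using le[of "- (c + 1)"] by (simp add: kl_dual_def)
  next
    case False
    have "((\<lambda>t. - ln (1 - y + y * exp t)) \<longlongrightarrow> - ln (1 - y + y * 0)) at_bot"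
      using False y by (intro tendsto_intros exp_at_bot) auto
    then have "- ln (1 - y + y * 0) \<le> c"
      using le by (intro tendsto_upperbound[of _ _ at_bot]) (auto simp: kl_dual_def)
    then show ?thesis
      using False y by (simp add: bernoulli_kl_def ln_div)
  qed
  have boundary: "y \<noteq> 0" if y: "y \<in> {0..1}" and le: "\<And>t. kl_dual t x y \<le> c" and "x > 0" for x y
  proof
    assume "y = 0"
    \<comment> \<open>For \<open>y = 0\<close> the logarithm vanishes and the dual is
      \<open>t * x\<close>, unbounded in \<open>t\<close>.\<close>
    then show False
      using le[of "(c + 1) / x"] \<open>x > 0\<close> by (simp add: kl_dual_def)
  qed
  have flipped: "kl_dual t (1 - x) (1 - y) \<le> c" for t
    using le[of "- t"] kl_dual_flip[OF y, of "- t" x] by simp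
  consider "x = 0" | "x = 1" | "x \<in> {0<..<1}"
    using x by fastforce
  then show ?thesis
  proof cases
    case 1
    then show ?thesis using zero[OF y] le by simp
  next
    case 2
    then show ?thesis
      using zero[of "1 - y"] y flipped bernoulli_kl_flip[of x y] by simp
  next
    case 3
    have "y \<noteq> 0" using boundary[OF y le] 3 by simp
    moreover have "y \<noteq> 1" using boundary[of "1 - y" "1 - x"] y flipped 3 by simp
    ultimately have y': "y \<in> {0<..<1}" using y by auto
    \<comment> \<open>the maximiser of the concave function \<open>\<lambda>t. kl_dual t x y\<close>\<close>
    define t where "t = ln (x * (1 - y) / (y * (1 - x)))"
    have "exp t = x * (1 - y) / (y * (1 - x))"
      using 3 y' by (simp add: t_def)
    then have Z: "1 - y + y * exp t = (1 - y) / (1 - x)"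
      using 3 y' by (simp add: field_simps)
    have t: "t = ln x + ln (1 - y) - ln y - ln (1 - x)"
      using 3 y' by (simp add: t_def ln_div ln_mult)
    have "kl_dual t x y = x * ln (x / y) + (1 - x) * ln ((1 - x) / (1 - y))"
      unfolding kl_dual_def Z using 3 y' by (simp add: t ln_div algebra_simps)
    then show ?thesis
      using 3 y' le[of t] by (simp add: bernoulli_kl_def)
  qed
qed

lemma bernoulli_kl_le_iff:
  assumes "x \<in> {0..1}" "y \<in> {0..1}"
  shows "bernoulli_kl x y \<le> ereal c \<longleftrightarrow> (\<forall>t. kl_dual t x y \<le> c)"
  using kl_dual_le_bernoulli_kl[OF assms] bernoulli_kl_le_if_kl_dual_le[OF assms]
  by (meson ereal_less_eq(3) order_trans)

section \<open>Sublevel sets and the confidence bounds\<close>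

definition kl_sublevel :: "real \<Rightarrow> real \<Rightarrow> real set" where
  "kl_sublevel c x = {y \<in> {0..1}. bernoulli_kl x y \<le> ereal c}"

lemma kl_sublevel_eq:
  assumes "x \<in> {0..1}"
  shows "kl_sublevel c x = {y \<in> {0..1}. \<forall>t. kl_dual t x y \<le> c}"
  using bernoulli_kl_le_iff[OF assms] by (auto simp: kl_sublevel_def)

text \<open>An intersection of closed conditions, one for each \<open>t\<close>. Each dual is
  real-valued and continuous on the whole interval, so infinite values of the entropy at the
  endpoints need no treatment.\<close>

lemma compact_kl_sublevel:
  assumes "x \<in> {0..1}"
  shows "compact (kl_sublevel c x)"
proof -
  have "closed {y \<in> {0..1}. kl_dual t x y \<le> c}" for t
    unfolding kl_dual_def using bernoulli_mgf_pos[of _ t]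
    by (intro continuous_on_closed_Collect_le continuous_intros) fastforce+
  then have "closed (\<Inter>t. {y \<in> {0..1}. kl_dual t x y \<le> c})"
    by (intro closed_INT) auto
  also have "(\<Inter>t. {y \<in> {0..1}. kl_dual t x y \<le> c}) = kl_sublevel c x"
    by (auto simp: kl_sublevel_eq[OF assms])
  finally show ?thesis
    unfolding compact_eq_bounded_closed
    by (auto intro: bounded_subset[of "{0..1}"] simp: kl_sublevel_def)
qed

lemma self_mem_kl_sublevel:
  assumes "x \<in> {0..1}" "c \<ge> 0"
  shows "x \<in> kl_sublevel c x"
  using assms kl_dual_le[of x _ x] by (auto simp: kl_sublevel_eq intro: order_trans)

text \<open>\<open>LEAST\<close> on the reals is meaningful only if the minimum is attained;
  compactness provides this, and \<open>x\<close> itself shows that the set is nonempty.\<close>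

lemma
  assumes x: "x \<in> {0..1}" and "n \<ge> 1" "\<delta> \<in> {0<..<1}"
  shows kl_lower_mem: "kl_lower x n \<delta> \<in> kl_sublevel (ln (1 / \<delta>) / real n) x"
    and kl_lower_le: "y \<in> kl_sublevel (ln (1 / \<delta>) / real n) x \<Longrightarrow> kl_lower x n \<delta> \<le> y"
proof -
  define c where "c = ln (1 / \<delta>) / real n"
  have "c \<ge> 0" using assms by (simp add: c_def)
  then have "kl_sublevel c x \<noteq> {}" using self_mem_kl_sublevel[OF x] by auto
  then obtain m where m: "m \<in> kl_sublevel c x" "\<And>y. y \<in> kl_sublevel c x \<Longrightarrow> m \<le> y"
    using compact_attains_inf[OF compact_kl_sublevel[OF x]] by metis
  have "kl_lower x n \<delta> = m"
    unfolding kl_lower_def using m by (intro Least_equality) (auto simp: kl_sublevel_def c_def)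
  then show "kl_lower x n \<delta> \<in> kl_sublevel (ln (1 / \<delta>) / real n) x"
    and "y \<in> kl_sublevel (ln (1 / \<delta>) / real n) x \<Longrightarrow> kl_lower x n \<delta> \<le> y"
    using m by (simp_all add: c_def)
qed

lemma kl_lower_le_self:
  assumes "x \<in> {0..1}" "n \<ge> 1" "\<delta> \<in> {0<..<1}"
  shows "kl_lower x n \<delta> \<le> x"
  using assms by (intro kl_lower_le self_mem_kl_sublevel) auto

lemma kl_upper_flip:
  assumes x: "x \<in> {0..1}" and n: "n \<ge> 1" "\<delta> \<in> {0<..<1}"
  shows "kl_upper x n \<delta> = 1 - kl_lower (1 - x) n \<delta>"
proof -
  have x': "1 - x \<in> {0..1}" using x by auto
  have flip: "1 - y \<in> kl_sublevel c (1 - x) \<longleftrightarrow> y \<in> kl_sublevel c x" for c y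
    by (auto simp: kl_sublevel_def bernoulli_kl_flip)
  show ?thesis
    unfolding kl_upper_def
  proof (rule Greatest_equality)
    show "1 - kl_lower (1 - x) n \<delta> \<in> {0..1} \<and>
        bernoulli_kl x (1 - kl_lower (1 - x) n \<delta>) \<le> ereal (ln (1 / \<delta>) / real n)"
      using kl_lower_mem[OF x' n] flip[of "1 - kl_lower (1 - x) n \<delta>"]
      by (simp add: kl_sublevel_def)
  next
    fix y assume "y \<in> {0..1} \<and> bernoulli_kl x y \<le> ereal (ln (1 / \<delta>) / real n)"
    then have "1 - y \<in> kl_sublevel (ln (1 / \<delta>) / real n) (1 - x)"
      unfolding flip by (simp add: kl_sublevel_def)
    from kl_lower_le[OF x' n this] show "y \<le> 1 - kl_lower (1 - x) n \<delta>" by simp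
  qed
qed

text \<open>Let \<open>y\<close> be the bound at the larger point. If \<open>x \<le> y\<close>, the
  bound at \<open>x\<close> is at most \<open>x\<close>. Otherwise \<open>y\<close> already lies in
  the sublevel set of \<open>x\<close>: tilts \<open>t \<ge> 0\<close> give a dual increasing in
  \<open>x\<close>, and negative tilts give a nonpositive one since \<open>x > y\<close>.\<close>

lemma mono_on_kl_lower:
  assumes n: "n \<ge> 1" "\<delta> \<in> {0<..<1}"
  shows "mono_on {0..1} (\<lambda>x. kl_lower x n \<delta>)"
proof (rule mono_onI)
  fix x x' :: real
  assume x: "x \<in> {0..1}" "x' \<in> {0..1}" "x \<le> x'"
  define c where "c = ln (1 / \<delta>) / real n"
  have c: "c \<ge> 0" using assms by (simp add: c_def)
  define y where "y = kl_lower x' n \<delta>"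
  have y: "y \<in> kl_sublevel c x'"
    using kl_lower_mem[OF x(2) n] by (simp add: y_def c_def)
  show "kl_lower x n \<delta> \<le> y"
  proof (cases "x \<le> y")
    case True
    then show ?thesis using kl_lower_le_self[OF x(1) n] by simp
  next
    case False
    have "kl_dual t x y \<le> c" for t
    proof (cases "t \<ge> 0")
      case True
      then have "t * x \<le> t * x'" using x by (intro mult_left_mono) auto
      then have "kl_dual t x y \<le> kl_dual t x' y" by (simp add: kl_dual_def)
      then show ?thesis using y by (auto simp: kl_sublevel_eq[OF x(2)] intro: order_trans)
    next
      case neg: False
      have "kl_dual t x y \<le> t * (x - y)"
        using y by (intro kl_dual_le) (simp add: kl_sublevel_def)
      also have "\<dots> \<le> 0" using neg False by (simp add: mult_nonpos_nonneg)
      finally show ?thesis using c by simp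
    qed
    then have "y \<in> kl_sublevel c x"
      using y by (auto simp: kl_sublevel_eq[OF x(1)] kl_sublevel_eq[OF x(2)])
    then show ?thesis using kl_lower_le[OF x(1) n] by (simp add: c_def)
  qed
qed

text \<open>Leaving the sublevel set yields a tilt with positive dual value, and
  \<open>y < x\<close> then fixes its sign. Nonnegativity is what an upper-tail Chernoff bound
  requires.\<close>

lemma less_kl_lower_imp:
  assumes x: "x \<in> {0..1}" and y: "y \<in> {0..1}" and n: "n \<ge> 1" "\<delta> \<in> {0<..<1}"
    and less: "y < kl_lower x n \<delta>"
  shows "\<exists>t\<ge>0. kl_dual t x y > ln (1 / \<delta>) / real n"
proof -
  define c where "c = ln (1 / \<delta>) / real n"
  have c: "c \<ge> 0" using assms by (simp add: c_def)
  have "y \<notin> kl_sublevel c x"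
    using kl_lower_le[OF x n, of y] less by (auto simp: c_def)
  then obtain t where t: "kl_dual t x y > c"
    using y by (auto simp: kl_sublevel_eq[OF x] not_le)
  have "0 < t * (x - y)" using c t kl_dual_le[OF y, of t x] by linarith
  moreover have "x - y > 0" using less kl_lower_le_self[OF x n] by simp
  ultimately have "t \<ge> 0" by (simp add: zero_less_mult_iff)
  then show ?thesis using t by (auto simp: c_def)
qed


section \<open>From single thresholds to up-closed sets of thresholds\<close>

text \<open>A nonempty \<open>T\<close> is a ray. If it contains its infimum, the bound at that
  point suffices; if not, it is an increasing union of closed rays.\<close>

lemma (in prob_space) prob_mem_up_closed_le:
  fixes X :: "'a \<Rightarrow> real"
  assumes X[measurable]: "X \<in> borel_measurable M"
    and up: "\<And>x y. x \<in> T \<Longrightarrow> x \<le> y \<Longrightarrow> y \<in> T"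
    and bdd: "bdd_below T"
    and le: "\<And>x. x \<in> T \<Longrightarrow> prob {w \<in> space M. x \<le> X w} \<le> p"
    and p: "p \<ge> 0"
  shows "prob {w \<in> space M. X w \<in> T} \<le> p"
proof (cases "T = {} \<or> Inf T \<in> T")
  case True
  show ?thesis
  proof (cases "T = {}")
    case False
    then have "Inf T \<in> T" using True by simp
    have "prob {w \<in> space M. X w \<in> T} \<le> prob {w \<in> space M. Inf T \<le> X w}"
      by (intro finite_measure_mono) (auto intro: cInf_lower bdd)
    with le[OF \<open>Inf T \<in> T\<close>] show ?thesis by simp
  qed (use p in simp)
next
  case False
  \<comment> \<open>Closed rays whose endpoints decrease to the excluded infimum; each endpoint lies
    in \<open>T\<close>, so the bound applies to every \<open>A k\<close> and passes to the
    limit.\<close>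
  define A where "A k = {w \<in> space M. Inf T + 1 / real (Suc k) \<le> X w}" for k
  have A_sets: "range A \<subseteq> sets M" by (auto simp: A_def)
  have "incseq A"
  proof (rule incseq_SucI, unfold A_def, safe)
    fix k w assume "Inf T + 1 / real (Suc k) \<le> X w"
    moreover have "1 / real (Suc (Suc k)) \<le> 1 / real (Suc k)" by (simp add: field_simps)
    ultimately show "Inf T + 1 / real (Suc (Suc k)) \<le> X w" by linarith
  qed
  then have "(\<lambda>k. prob (A k)) \<longlonglongrightarrow> prob (\<Union>k. A k)"
    by (rule finite_Lim_measure_incseq[OF A_sets])
  moreover have "prob (A k) \<le> p" for k
  proof -
    have "\<exists>x\<in>T. x < Inf T + 1 / real (Suc k)"
      using False bdd by (subst cInf_less_iff[symmetric]) auto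
    then have "Inf T + 1 / real (Suc k) \<in> T" by (meson up less_imp_le)
    then show ?thesis unfolding A_def by (rule le)
  qed
  ultimately have "prob (\<Union>k. A k) \<le> p"
    by (intro LIMSEQ_le_const2) auto
  moreover have "{w \<in> space M. X w \<in> T} \<subseteq> (\<Union>k. A k)"
  proof safe
    fix w assume w: "w \<in> space M" "X w \<in> T"
    then have "Inf T < X w"
      using False cInf_lower[OF w(2) bdd] by (cases "X w = Inf T") auto
    then obtain k where "1 / real (Suc k) < X w - Inf T"
      using nat_approx_posE[of "X w - Inf T"] by auto
    then show "w \<in> (\<Union>k. A k)" using w by (auto simp: A_def intro!: exI[of _ k])
  qed
  then have "prob {w \<in> space M. X w \<in> T} \<le> prob (\<Union>k. A k)"
    using A_sets by (intro finite_measure_mono) auto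
  ultimately show ?thesis by simp
qed

section \<open>Chernoff bounds for sample means of functions into the unit interval\<close>

definition sample_mean :: "('q \<Rightarrow> real) \<Rightarrow> nat \<Rightarrow> (nat \<Rightarrow> 'q) \<Rightarrow> real" where
  "sample_mean f n q = (1 / real n) * (\<Sum>i=1..n. f (q i))"

locale unit_interval_sample = prob_space D for D :: "'q measure" +
  fixes f :: "'q \<Rightarrow> real" and n :: nat
  assumes f_measurable[measurable]: "f \<in> borel_measurable D"
    and f_range: "\<And>q. q \<in> space D \<Longrightarrow> f q \<in> {0..1}"
    and n_pos: "n \<ge> 1"
begin

text \<open>Lets every result on lower confidence bounds be reused for upper ones.\<close>

lemma complement: "unit_interval_sample D (\<lambda>q. 1 - f q) n"
  using f_range n_pos by unfold_locales auto

lemma integrable_f: "integrable D f"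
  using f_range by (intro integrable_const_bound[of _ 1]) auto

lemma expectation_range: "expectation f \<in> {0..1}"
proof -
  have "expectation f \<ge> 0" using f_range by (intro integral_nonneg_AE) auto
  moreover have "expectation f \<le> 1"
    using f_range integrable_f by (intro integral_le_const) auto
  ultimately show ?thesis by simp
qed

lemma prob_space_sample: "prob_space (sample_space D n)"
  by (intro prob_space_PiM prob_space_axioms)

lemma sample_mean_measurable[measurable]:
  "sample_mean f n \<in> borel_measurable (sample_space D n)"
  unfolding sample_mean_def by measurable

lemma sample_mean_range:
  assumes "q \<in> space (sample_space D n)"
  shows "sample_mean f n q \<in> {0..1}"
proof -
  have q: "f (q i) \<in> {0..1}" if "i \<in> {1..n}" for i
    using assms that by (intro f_range) (auto simp: space_PiM)
  then have "(\<Sum>i=1..n. f (q i)) \<ge> 0" by (intro sum_nonneg) auto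
  moreover have "(\<Sum>i=1..n. f (q i)) \<le> (\<Sum>i=1..n. 1)" using q by (intro sum_mono) auto
  ultimately show ?thesis using n_pos by (auto simp: sample_mean_def field_simps)
qed

lemma sample_mean_complement: "sample_mean (\<lambda>q. 1 - f q) n q = 1 - sample_mean f n q"
  using n_pos by (simp add: sample_mean_def sum_subtractf field_simps)

lemma expectation_complement: "expectation (\<lambda>q. 1 - f q) = 1 - expectation f"
  using integrable_f by (simp add: prob_space)

lemma integrable_exp: "integrable D (\<lambda>q. exp (t * f q))"
proof (rule integrable_const_bound[of _ "exp \<bar>t\<bar>"])
  have "t * f q \<le> \<bar>t\<bar>" if "q \<in> space D" for q
  proof -
    have "t * f q \<le> \<bar>t\<bar> * f q" using f_range[OF that] by (intro mult_right_mono) auto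
    also have "\<dots> \<le> \<bar>t\<bar> * 1" using f_range[OF that] by (intro mult_left_mono) auto
    finally show ?thesis by simp
  qed
  then show "AE q in D. norm (exp (t * f q)) \<le> exp \<bar>t\<bar>" by auto
qed measurable

text \<open>By convexity \<open>exp\<close> lies below its chord, so among variables in the unit
  interval with a given mean the Bernoulli one has the largest moment generating function. Hence
  Bernoulli entropy controls arbitrary scores.\<close>

lemma mgf_le_bernoulli: "expectation (\<lambda>q. exp (t * f q)) \<le> 1 - expectation f + expectation f * exp t"
proof -
  have "exp (t * f q) \<le> 1 - f q + f q * exp t" if "q \<in> space D" for q
  proof -
    have "exp ((1 - f q) *\<^sub>R 0 + f q *\<^sub>R t) \<le> (1 - f q) * exp 0 + f q * exp t"
      using f_range[OF that] by (intro convex_onD[OF exp_convex]) auto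
    then show ?thesis by (simp add: mult.commute)
  qed
  then have "expectation (\<lambda>q. exp (t * f q)) \<le> expectation (\<lambda>q. 1 - f q + f q * exp t)"
    using integrable_f integrable_exp by (intro integral_mono) auto
  also have "\<dots> = 1 - expectation f + expectation f * exp t"
    using integrable_f by (simp add: prob_space)
  finally show ?thesis .
qed

text \<open>Markov's inequality for \<open>exp (t * sum)\<close>, whose expectation factorises over
  the product measure.\<close>

lemma prob_sample_mean_ge_le:
  assumes "t \<ge> 0"
  shows "\<P>(q in sample_space D n. x \<le> sample_mean f n q)
    \<le> exp (- real n * kl_dual t x (expectation f))"
proof -
  interpret product_sigma_finite "\<lambda>_::nat. D"
    by unfold_locales
  interpret P: prob_space "sample_space D n" by (rule prob_space_sample)
  define u where "u q = (\<Prod>i=1..n. exp (t * f (q i)))" for q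
  define b where "b = 1 - expectation f + expectation f * exp t"
  have b: "b > 0" using bernoulli_mgf_pos[OF expectation_range] by (simp add: b_def)
  have u_eq: "u q = exp (t * (real n * sample_mean f n q))" for q
    using n_pos by (simp add: u_def sample_mean_def sum_distrib_left exp_sum)
  have u_nonneg: "u q \<ge> 0" for q
    by (simp add: u_eq)
  have u_int: "integrable (sample_space D n) u"
    unfolding u_def by (intro product_integrable_prod integrable_exp) simp
  have "\<P>(q in sample_space D n. x \<le> sample_mean f n q)
      \<le> \<P>(q in sample_space D n. exp (t * (real n * x)) \<le> u q)"
    using assms u_int by (intro P.finite_measure_mono) (auto simp: u_eq simp del: One_nat_def intro!: mult_left_mono)
  also have "\<dots> \<le> (\<integral>q. u q \<partial>sample_space D n) / exp (t * (real n * x))"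
    using u_int u_nonneg by (intro integral_Markov_inequality_measure[where A = "{}"]) auto
  also have "(\<integral>q. u q \<partial>sample_space D n) = expectation (\<lambda>q. exp (t * f q)) ^ n"
    unfolding u_def by (subst product_integral_prod) (auto intro: integrable_exp)
  also have "\<dots> / exp (t * (real n * x)) \<le> b ^ n / exp (t * (real n * x))"
    using mgf_le_bernoulli[of t] by (intro divide_right_mono power_mono) (auto simp: b_def)
  also have "b ^ n = exp (real n * ln b)"
    using b by (simp add: exp_of_nat_mult)
  also have "exp (real n * ln b) / exp (t * (real n * x)) = exp (- real n * kl_dual t x (expectation f))"
    by (simp add: kl_dual_def b_def algebra_simps flip: exp_diff)
  finally show ?thesis .
qed

lemma kl_lower_measurable[measurable]:
  assumes "\<delta> \<in> {0<..<1}"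
  shows "(\<lambda>q. kl_lower (sample_mean f n q) n \<delta>) \<in> borel_measurable (sample_space D n)"
proof -
  \<comment> \<open>Monotonicity is known only on the unit interval; clamping the argument extends
    it to all reals and changes nothing at sample means.\<close>
  define g where "g x = kl_lower (max 0 (min 1 x)) n \<delta>" for x
  have "mono g"
    unfolding g_def by (intro monoI mono_onD[OF mono_on_kl_lower[OF n_pos assms]]) auto
  then have "g \<in> borel_measurable borel" by (rule borel_measurable_mono)
  then have "(\<lambda>q. g (sample_mean f n q)) \<in> borel_measurable (sample_space D n)" by measurable
  moreover have "g (sample_mean f n q) = kl_lower (sample_mean f n q) n \<delta>"
    if "q \<in> space (sample_space D n)" for q
    using sample_mean_range[OF that] by (simp add: g_def)
  ultimately show ?thesis by (subst measurable_cong[where g = "\<lambda>q. g (sample_mean f n q)"]) auto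
qed

lemma prob_less_kl_lower_le:
  assumes \<delta>: "\<delta> \<in> {0<..<1}"
  shows "\<P>(q in sample_space D n. expectation f < kl_lower (sample_mean f n q) n \<delta>) \<le> \<delta>"
proof -
  interpret P: prob_space "sample_space D n" by (rule prob_space_sample)
  define c where "c = ln (1 / \<delta>) / real n"
  have c: "c \<ge> 0" using \<delta> by (simp add: c_def)
  \<comment> \<open>The tilt may depend on the threshold, hence on the observed mean, so no single
    Chernoff bound covers the event.\<close>
  define T where "T = {x. \<exists>t\<ge>0. kl_dual t x (expectation f) > c}"
  have up: "y \<in> T" if "x \<in> T" "x \<le> y" for x y
  proof -
    obtain t where t: "t \<ge> 0" "kl_dual t x (expectation f) > c"
      using \<open>x \<in> T\<close> by (auto simp: T_def)
    moreover have "t * x \<le> t * y" using t that by (intro mult_left_mono) auto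
    ultimately show ?thesis by (auto simp: T_def kl_dual_def intro!: exI[of _ t])
  qed
  have bdd: "bdd_below T"
  proof (rule bdd_belowI[of _ "expectation f"])
    fix x assume "x \<in> T"
    then obtain t where t: "t \<ge> 0" "kl_dual t x (expectation f) > c" by (auto simp: T_def)
    then have "0 < t * (x - expectation f)"
      using c kl_dual_le[OF expectation_range, of t x] by linarith
    then show "expectation f \<le> x" using t by (simp add: zero_less_mult_iff)
  qed
  have le: "\<P>(q in sample_space D n. x \<le> sample_mean f n q) \<le> \<delta>" if "x \<in> T" for x
  proof -
    obtain t where t: "t \<ge> 0" "kl_dual t x (expectation f) > c"
      using \<open>x \<in> T\<close> by (auto simp: T_def)
    have "exp (- real n * kl_dual t x (expectation f)) \<le> exp (- real n * c)"
      using t by (auto intro!: mult_left_mono)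
    \<comment> \<open>The level \<open>c\<close> is calibrated so that
      \<open>n * c = ln (1 / \<delta>)\<close>.\<close>
    also have "\<dots> = \<delta>" using \<delta> n_pos by (simp add: c_def ln_div)
    finally show ?thesis using prob_sample_mean_ge_le[OF t(1), of x] by linarith
  qed
  \<comment> \<open>The existential ranges over uncountably many tilts, but a union of open sets is
    open.\<close>
  have T_borel: "T \<in> sets borel"
  proof -
    have "T = (\<Union>t\<in>{0..}. {x. c < kl_dual t x (expectation f)})" by (auto simp: T_def)
    also have "open \<dots>" unfolding kl_dual_def by (intro open_UN ballI open_Collect_less continuous_intros)
    finally show ?thesis by simp
  qed
  have "sample_mean f n q \<in> T"
    if "q \<in> space (sample_space D n)" "expectation f < kl_lower (sample_mean f n q) n \<delta>" for q
    using less_kl_lower_imp[OF sample_mean_range[OF that(1)] expectation_range n_pos \<delta> that(2)]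
    by (simp add: T_def c_def)
  then have "\<P>(q in sample_space D n. expectation f < kl_lower (sample_mean f n q) n \<delta>)
      \<le> \<P>(q in sample_space D n. sample_mean f n q \<in> T)"
    using measurable_sets[OF sample_mean_measurable T_borel]
    by (intro P.finite_measure_mono) (auto simp: vimage_def Int_def conj_commute)
  also have "\<dots> \<le> \<delta>"
    using P.prob_mem_up_closed_le[OF sample_mean_measurable up bdd le] \<delta> by simp
  finally show ?thesis .
qed

lemma kl_upper_sample_mean:
  assumes "q \<in> space (sample_space D n)" "\<delta> \<in> {0<..<1}"
  shows "kl_upper (sample_mean f n q) n \<delta> = 1 - kl_lower (sample_mean (\<lambda>q. 1 - f q) n q) n \<delta>"
  using kl_upper_flip[OF sample_mean_range[OF assms(1)] n_pos assms(2)]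
  by (simp only: sample_mean_complement)

lemma kl_upper_measurable[measurable]:
  assumes "\<delta> \<in> {0<..<1}"
  shows "(\<lambda>q. kl_upper (sample_mean f n q) n \<delta>) \<in> borel_measurable (sample_space D n)"
proof -
  interpret C: unit_interval_sample D "\<lambda>q. 1 - f q" n by (rule complement)
  have "(\<lambda>q. 1 - kl_lower (sample_mean (\<lambda>q. 1 - f q) n q) n \<delta>) \<in> borel_measurable (sample_space D n)"
    using C.kl_lower_measurable[OF assms] by measurable
  then show ?thesis
    by (subst measurable_cong[OF kl_upper_sample_mean[OF _ assms]])
qed

lemma prob_kl_upper_less_le:
  assumes "\<delta> \<in> {0<..<1}"
  shows "\<P>(q in sample_space D n. kl_upper (sample_mean f n q) n \<delta> < expectation f) \<le> \<delta>"
proof -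
  interpret C: unit_interval_sample D "\<lambda>q. 1 - f q" n by (rule complement)
  have "{q \<in> space (sample_space D n). kl_upper (sample_mean f n q) n \<delta> < expectation f} =
    {q \<in> space (sample_space D n).
      expectation (\<lambda>q. 1 - f q) < kl_lower (sample_mean (\<lambda>q. 1 - f q) n q) n \<delta>}"
    using kl_upper_sample_mean[OF _ assms] by (auto simp: expectation_complement)
  then show ?thesis using C.prob_less_kl_lower_le[OF assms] by simp
qed

end

section \<open>Error probabilities of the testing procedure\<close>

theorem theorem1:
  fixes Q :: "'q set" and D :: "'q measure" and A :: "'a set" and idk :: 'a
    and S :: "'q \<Rightarrow> 'a \<Rightarrow> real" and ans :: "'q \<Rightarrow> 'a"
    and PG RID \<delta> :: real and n :: nat
  assumes "qa_domain Q D A idk S"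
    and "understanding_criterion PG RID"
    and "ans \<in> Q \<rightarrow> A"
    and "(\<lambda>q. S q (ans q)) \<in> borel_measurable D"
    and "n \<ge> 1"
    and "\<delta> \<in> {0<..<1}"
  shows "understanding_test S ans PG RID n \<delta> \<in> measurable (sample_space D n) (count_space UNIV)
    \<and> \<P>(q in sample_space D n.
          incorrect (understands D S PG RID ans) (understanding_test S ans PG RID n \<delta> q)) \<le> \<delta>
    \<and> (\<not> understands D S PG RID ans \<longrightarrow>
         \<P>(q in sample_space D n. understanding_test S ans PG RID n \<delta> q = Understands) \<le> \<delta>)
    \<and> (understands D S PG RID ans \<longrightarrow>
         \<P>(q in sample_space D n. understanding_test S ans PG RID n \<delta> q = Does_Not_Understand) \<le> \<delta>)"
proof -
  interpret qa_domain Q D A idk S by fact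
  define f where "f q = S q (ans q)" for q
  define g where "g q = (if ridiculous S q (ans q) then 1 else 0 :: real)" for q
  have f_meas[measurable]: "f \<in> borel_measurable D"
    using assms(4) by (simp add: f_def[abs_def])
  \<comment> \<open>Agreement on the space of \<open>D\<close> is enough both for measurability and
    for identifying the mean of \<open>g\<close> with the probability of a ridiculous
    answer.\<close>
  have g_eq: "g q = indicator {q \<in> space D. f q = 0} q" if "q \<in> space D" for q
    using that by (simp add: g_def ridiculous_def f_def)
  then have g_meas[measurable]: "g \<in> borel_measurable D"
    by (simp cong: measurable_cong)
  interpret F: unit_interval_sample D f n
    using assms(3,5) score_range by unfold_locales (auto simp: f_def space_D Pi_iff)
  interpret G: unit_interval_sample D g n
    using assms(5) by unfold_locales (auto simp: g_def)
  interpret P: prob_space "sample_space D n" by (rule F.prob_space_sample)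
  have score: "sample_score S ans n q = sample_mean f n q" for q
    by (simp add: sample_score_def sample_mean_def f_def)
  have rid: "sample_ridiculous S ans n q = sample_mean g n q" for q
    by (simp add: sample_ridiculous_def sample_mean_def g_def)
  have s: "expected_score D S ans = expectation f"
    by (simp add: expected_score_def f_def[abs_def])
  have r: "ridiculous_prob D S ans = expectation g"
  proof -
    have "expectation g = expectation (indicator {q \<in> space D. f q = 0})"
      using g_eq by (intro Bochner_Integration.integral_cong) auto
    then show ?thesis by (simp add: ridiculous_prob_def ridiculous_def f_def Int_def conj_commute)
  qed
  have \<delta>: "\<delta> \<in> {0<..<1}" "\<delta> / 2 \<in> {0<..<1}" using assms(6) by auto
  note [measurable] = F.kl_lower_measurable[OF \<delta>(1)] F.kl_upper_measurable[OF \<delta>(2)]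
    G.kl_upper_measurable[OF \<delta>(1)] G.kl_lower_measurable[OF \<delta>(2)]
  have test_meas[measurable]:
    "understanding_test S ans PG RID n \<delta> \<in> measurable (sample_space D n) (count_space UNIV)"
    unfolding understanding_test_def[abs_def] score rid by measurable
  have false_positive: "\<P>(q in sample_space D n. understanding_test S ans PG RID n \<delta> q = Understands) \<le> \<delta>"
    if "\<not> understands D S PG RID ans"
  \<comment> \<open>Which criterion is violated depends on the true means and not on the sample, so
    no union bound is needed and the full \<delta> is available.\<close>
  proof (cases "expectation f < PG")
    case True
    have "\<P>(q in sample_space D n. understanding_test S ans PG RID n \<delta> q = Understands)
        \<le> \<P>(q in sample_space D n. expectation f < kl_lower (sample_mean f n q) n \<delta>)"
      using True by (intro P.finite_measure_mono)
        (auto simp: understanding_test_def score rid simp del: One_nat_def split: if_splits)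
    also have "\<dots> \<le> \<delta>" by (rule F.prob_less_kl_lower_le[OF \<delta>(1)])
    finally show ?thesis .
  next
    case False
    then have "RID < expectation g"
      using that by (simp add: understands_def s r)
    then have "\<P>(q in sample_space D n. understanding_test S ans PG RID n \<delta> q = Understands)
        \<le> \<P>(q in sample_space D n. kl_upper (sample_mean g n q) n \<delta> < expectation g)"
      by (intro P.finite_measure_mono)
        (auto simp: understanding_test_def score rid simp del: One_nat_def split: if_splits)
    also have "\<dots> \<le> \<delta>" by (rule G.prob_kl_upper_less_le[OF \<delta>(1)])
    finally show ?thesis .
  qed
  have false_negative:
    "\<P>(q in sample_space D n. understanding_test S ans PG RID n \<delta> q = Does_Not_Understand) \<le> \<delta>"
    if "understands D S PG RID ans"
  proof -
    have "PG \<le> expectation f" "expectation g \<le> RID"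
      using that by (simp_all add: understands_def s r)
    \<comment> \<open>Either disjunct of the negative test may fire wrongly, so both failure events
      must be covered.\<close>
    then have "\<P>(q in sample_space D n. understanding_test S ans PG RID n \<delta> q = Does_Not_Understand)
        \<le> P.prob ({q \<in> space (sample_space D n). kl_upper (sample_mean f n q) n (\<delta> / 2) < expectation f}
          \<union> {q \<in> space (sample_space D n). expectation g < kl_lower (sample_mean g n q) n (\<delta> / 2)})"
      by (intro P.finite_measure_mono)
        (auto simp: understanding_test_def score rid simp del: One_nat_def split: if_splits)
    also have "\<dots> \<le> \<P>(q in sample_space D n. kl_upper (sample_mean f n q) n (\<delta> / 2) < expectation f)
        + \<P>(q in sample_space D n. expectation g < kl_lower (sample_mean g n q) n (\<delta> / 2))"
      by (intro measure_Un_le) measurable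
    also have "\<dots> \<le> \<delta> / 2 + \<delta> / 2"
      by (intro add_mono F.prob_kl_upper_less_le[OF \<delta>(2)] G.prob_less_kl_lower_le[OF \<delta>(2)])
    finally show ?thesis by simp
  qed
  \<comment> \<open>Once the truth is fixed only one verdict is wrong, so the overall error bound
    follows from the two conditional ones.\<close>
  have incorrect_iff: "incorrect b v \<longleftrightarrow> v = (if b then Does_Not_Understand else Understands)" for b v
    by (cases v) auto
  show ?thesis
    using test_meas false_positive false_negative by (auto simp: incorrect_iff)
qed

end
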